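(* Let $m_{\mathcal S}\ge 3$ be fixed, and for $n\ge 1$ let $N_p$ be the number of lumpable partitions (equivalence classes of states) within the Markov arrival process (MAP) representing the level superposition of $n$ symmetric sub-trees with refined identical individual MAPs having $m_{\mathcal S}$ states each. Then $N_p$ is bounded by a polynomial function of $n$: $$N_p=\mathcal O\bigl(n^{m_{\mathcal S}}\bigr)\qquad (n\to\infty).$$
   Context: The level superposition of $n$ MAPs is the MAP formed by the Kronecker sums of their transition matrices; when the $n$ MAPs are identical with state set $\mathcal S$, $|\mathcal S|=m_{\mathcal S}$, its state set is $\mathcal S^n$, whose elements are tuples $A=(A_1,\dots,A_n)$, $A_j\in\mathcal S$ being the state of sub-tree $j$. A MAP is called refined if no two distinct states of it are equivalent. The equivalence on $\mathcal S^n$ is then the one induced by permutations of the $n$ symmetric sub-trees: $A,B\in\mathcal S^n$ are equivalent iff there is a permutation $f$ of $\{1,\dots,n\}$ with $A_i=B_{f(i)}$ for all $i$. A lumpable partition is one equivalence class of this relation, and $N_p$ is the number of equivalence classes. *)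

theory Defs
  imports "HOL-Analysis.Analysis" "HOL-Library.Landau_Symbols"
begin

text \<open>A Markov arrival process with states \<open>mstates\<close>: \<open>hidden s t\<close> is the rate of jumping
  from \<open>s\<close> to \<open>t\<close> without an arrival, \<open>active s t\<close> the rate of jumping with an arrival
  (the matrices usually written \<open>D0\<close> and \<open>D1\<close>).  Only entries indexed by members of
  \<open>mstates\<close> are meaningful.\<close>

record 'a markov_ap =
  mstates :: "'a set"
  hidden :: "'a \<Rightarrow> 'a \<Rightarrow> real"
  active :: "'a \<Rightarrow> 'a \<Rightarrow> real"

definition is_MAP :: "'a markov_ap \<Rightarrow> bool" where
  "is_MAP M \<longleftrightarrow> finite (mstates M) \<and> mstates M \<noteq> {} \<and>
     (\<forall>s\<in>mstates M. \<forall>t\<in>mstates M. s \<noteq> t \<longrightarrow> 0 \<le> hidden M s t) \<and>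
     (\<forall>s\<in>mstates M. \<forall>t\<in>mstates M. 0 \<le> active M s t) \<and>
     (\<forall>s\<in>mstates M. (\<Sum>t\<in>mstates M. hidden M s t + active M s t) = 0)"

text \<open>Ordinary (strong) lumpability with respect to both transition matrices.\<close>

definition lumpable :: "'a markov_ap \<Rightarrow> 'a rel \<Rightarrow> bool" where
  "lumpable M R \<longleftrightarrow> equiv (mstates M) R \<and>
     (\<forall>(s, t)\<in>R. \<forall>C\<in>mstates M // R.
        (\<Sum>u\<in>C. hidden M s u) = (\<Sum>u\<in>C. hidden M t u) \<and>
        (\<Sum>u\<in>C. active M s u) = (\<Sum>u\<in>C. active M t u))"

definition equivalent_states :: "'a markov_ap \<Rightarrow> 'a \<Rightarrow> 'a \<Rightarrow> bool" where
  "equivalent_states M s t \<longleftrightarrow> (\<exists>R. lumpable M R \<and> (s, t) \<in> R)"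

definition refined :: "'a markov_ap \<Rightarrow> bool" where
  "refined M \<longleftrightarrow>
     (\<forall>s\<in>mstates M. \<forall>t\<in>mstates M. s \<noteq> t \<longrightarrow> \<not> equivalent_states M s t)"

text \<open>The entry of \<open>D 1 \<oplus> \<dots> \<oplus> D n\<close> at the tuples \<open>A\<close>, \<open>B\<close>: the summand \<open>j\<close> is the
  Kronecker product \<open>I \<otimes> \<dots> \<otimes> D j \<otimes> \<dots> \<otimes> I\<close>.  Tuples are extensional functions on
  \<open>{1..n}\<close>.\<close>

definition kronecker_sum ::
    "nat \<Rightarrow> (nat \<Rightarrow> 'a \<Rightarrow> 'a \<Rightarrow> real) \<Rightarrow> (nat \<Rightarrow> 'a) \<Rightarrow> (nat \<Rightarrow> 'a) \<Rightarrow> real" where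
  "kronecker_sum n D A B =
     (\<Sum>j\<in>{1..n}. D j (A j) (B j) * (\<Prod>i\<in>{1..n} - {j}. if A i = B i then 1 else 0))"

definition level_superposition ::
    "nat \<Rightarrow> (nat \<Rightarrow> 'a markov_ap) \<Rightarrow> (nat \<Rightarrow> 'a) markov_ap" where
  "level_superposition n M =
     \<lparr>mstates = (\<Pi>\<^sub>E j\<in>{1..n}. mstates (M j)),
      hidden = kronecker_sum n (\<lambda>j. hidden (M j)),
      active = kronecker_sum n (\<lambda>j. active (M j))\<rparr>"

abbreviation symmetric_superposition :: "nat \<Rightarrow> 'a markov_ap \<Rightarrow> (nat \<Rightarrow> 'a) markov_ap" where
  "symmetric_superposition n M \<equiv> level_superposition n (\<lambda>_. M)"

definition subtree_equivalence :: "nat \<Rightarrow> 'a markov_ap \<Rightarrow> (nat \<Rightarrow> 'a) rel" where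
  "subtree_equivalence n M =
     {(A, B). A \<in> mstates (symmetric_superposition n M) \<and>
              B \<in> mstates (symmetric_superposition n M) \<and>
              (\<exists>f. f permutes {1..n} \<and> (\<forall>i\<in>{1..n}. A i = B (f i)))}"

definition lumpable_partitions :: "nat \<Rightarrow> 'a markov_ap \<Rightarrow> (nat \<Rightarrow> 'a) set set" where
  "lumpable_partitions n M =
     mstates (symmetric_superposition n M) // subtree_equivalence n M"

definition num_lumpable_partitions :: "nat \<Rightarrow> 'a markov_ap \<Rightarrow> nat" where
  "num_lumpable_partitions n M = card (lumpable_partitions n M)"

lemma mstates_symmetric_superposition [simp]:
  "mstates (symmetric_superposition n M) = {1..n} \<rightarrow>\<^sub>E mstates M"
  by (simp add: level_superposition_def)

lemma subtree_equivalence_iff: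
  "(A, B) \<in> subtree_equivalence n M \<longleftrightarrow>
     B \<in> ({1..n} \<rightarrow>\<^sub>E mstates M) \<and> (\<exists>f. f permutes {1..n} \<and> A = B \<circ> f)"
proof
  assume "(A, B) \<in> subtree_equivalence n M"
  then obtain f where A: "A \<in> {1..n} \<rightarrow>\<^sub>E mstates M" and B: "B \<in> {1..n} \<rightarrow>\<^sub>E mstates M"
    and f: "f permutes {1..n}" and AB: "\<forall>i\<in>{1..n}. A i = B (f i)"
    unfolding subtree_equivalence_def by auto
  have "A i = (B \<circ> f) i" for i
  proof (cases "i \<in> {1..n}")
    case False
    then show ?thesis
      using PiE_arb[OF A False] PiE_arb[OF B False] permutes_not_in[OF f False] by simp
  qed (use AB in simp)
  then show "B \<in> ({1..n} \<rightarrow>\<^sub>E mstates M) \<and> (\<exists>f. f permutes {1..n} \<and> A = B \<circ> f)"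
    using B f by blast
next
  assume "B \<in> ({1..n} \<rightarrow>\<^sub>E mstates M) \<and> (\<exists>f. f permutes {1..n} \<and> A = B \<circ> f)"
  then obtain f where B: "B \<in> {1..n} \<rightarrow>\<^sub>E mstates M" and f: "f permutes {1..n}"
    and A: "A = B \<circ> f" by blast
  have "A \<in> {1..n} \<rightarrow>\<^sub>E mstates M"
  proof (rule PiE_I)
    fix i assume "i \<in> {1..n}"
    then have "f i \<in> {1..n}" by (simp only: permutes_in_image[OF f])
    then show "A i \<in> mstates M" unfolding A o_def by (rule PiE_mem[OF B])
  next
    fix i assume i: "i \<notin> {1..n}"
    then show "A i = undefined"
      using PiE_arb[OF B i] permutes_not_in[OF f i] by (simp add: A)
  qed
  then show "(A, B) \<in> subtree_equivalence n M"
    using A B f unfolding subtree_equivalence_def by auto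
qed

lemma equiv_subtree_equivalence:
  "equiv (mstates (symmetric_superposition n M)) (subtree_equivalence n M)"
proof (rule equivI)
  show "subtree_equivalence n M \<subseteq>
      mstates (symmetric_superposition n M) \<times> mstates (symmetric_superposition n M)"
    by (auto simp: subtree_equivalence_def)
  show "refl_on (mstates (symmetric_superposition n M)) (subtree_equivalence n M)"
  proof (rule refl_onI)
    fix A assume "A \<in> mstates (symmetric_superposition n M)"
    then show "(A, A) \<in> subtree_equivalence n M"
      unfolding subtree_equivalence_iff by (auto intro!: exI[of _ id] permutes_id)
  qed
  show "sym (subtree_equivalence n M)"
  proof (rule symI)
    fix A B assume AB: "(A, B) \<in> subtree_equivalence n M"
    then obtain f where f: "f permutes {1..n}" "A = B \<circ> f"
      unfolding subtree_equivalence_iff by blast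
    moreover have "B = A \<circ> inv f"
      using f by (simp add: comp_assoc permutes_inv_o)
    moreover have "A \<in> {1..n} \<rightarrow>\<^sub>E mstates M"
      using AB by (auto simp: subtree_equivalence_def)
    ultimately show "(B, A) \<in> subtree_equivalence n M"
      unfolding subtree_equivalence_iff using permutes_inv by blast
  qed
  show "trans (subtree_equivalence n M)"
  proof (rule transI)
    fix A B C
    assume "(A, B) \<in> subtree_equivalence n M" "(B, C) \<in> subtree_equivalence n M"
    then show "(A, C) \<in> subtree_equivalence n M"
      unfolding subtree_equivalence_iff by (metis comp_assoc permutes_compose)
  qed
qed

lemma kronecker_sum_permute:
  assumes f: "f permutes {1..n}"
  shows "kronecker_sum n (\<lambda>_. D) (A \<circ> f) (B \<circ> f) = kronecker_sum n (\<lambda>_. D) A B"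
proof -
  let ?d = "\<lambda>i. if A i = B i then 1 else (0::real)"
  have "(\<Prod>i\<in>{1..n} - {j}. ?d (f i)) = (\<Prod>i\<in>{1..n} - {f j}. ?d i)" for j
  proof (rule prod.reindex_bij_betw[of f _ _ ?d])
    have "f ` ({1..n} - {j}) = {1..n} - {f j}"
      unfolding image_set_diff[OF permutes_inj[OF f]] permutes_image[OF f] by simp
    then show "bij_betw f ({1..n} - {j}) ({1..n} - {f j})"
      using permutes_inj_on[OF f] by (auto simp: bij_betw_def)
  qed
  then have "kronecker_sum n (\<lambda>_. D) (A \<circ> f) (B \<circ> f) =
      (\<Sum>j\<in>{1..n}. D (A (f j)) (B (f j)) * (\<Prod>i\<in>{1..n} - {f j}. ?d i))"
    by (simp add: kronecker_sum_def)
  also have "\<dots> = kronecker_sum n (\<lambda>_. D) A B"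
    unfolding kronecker_sum_def
    by (rule sum.reindex_bij_betw[OF permutes_imp_bij[OF f],
          of "\<lambda>j. D (A j) (B j) * (\<Prod>i\<in>{1..n} - {j}. ?d i)"])
  finally show ?thesis .
qed

lemma lumpable_subtree_equivalence:
  "lumpable (symmetric_superposition n M) (subtree_equivalence n M)"
proof -
  let ?X = "{1..n} \<rightarrow>\<^sub>E mstates M" and ?R = "subtree_equivalence n M"
  note E = equiv_subtree_equivalence[of n M]
  have "(\<Sum>U\<in>C. kronecker_sum n (\<lambda>_. D) A U) = (\<Sum>U\<in>C. kronecker_sum n (\<lambda>_. D) B U)"
    if AB: "(A, B) \<in> ?R" and C: "C \<in> ?X // ?R" for A B C and D :: "'a \<Rightarrow> 'a \<Rightarrow> real"
  proof -
    obtain f where f: "f permutes {1..n}" and A: "A = B \<circ> f"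
      using AB unfolding subtree_equivalence_iff by blast
    have closed: "U \<circ> g \<in> C" if "U \<in> C" "g permutes {1..n}" for U g
    proof -
      have "U \<in> ?X"
        using in_quotient_imp_subset[OF E] C that(1) by auto
      then have "(U \<circ> g, U) \<in> ?R"
        using that(2) unfolding subtree_equivalence_iff by blast
      then have "(U, U \<circ> g) \<in> ?R"
        using E by (meson equivE symE)
      then show ?thesis
        using in_quotient_imp_closed[OF E _ that(1)] C by simp
    qed
    have "bij_betw (\<lambda>U. U \<circ> f) C C"
    proof (rule bij_betwI[where g = "\<lambda>U. U \<circ> inv f"])
      show "(\<lambda>U. U \<circ> f) \<in> C \<rightarrow> C" "(\<lambda>U. U \<circ> inv f) \<in> C \<rightarrow> C"
        using closed f permutes_inv[OF f] by auto
    qed (simp_all add: comp_assoc permutes_inv_o[OF f])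
    then have "(\<Sum>U\<in>C. kronecker_sum n (\<lambda>_. D) A U) =
        (\<Sum>U\<in>C. kronecker_sum n (\<lambda>_. D) A (U \<circ> f))"
      by (rule sum.reindex_bij_betw[symmetric])
    then show ?thesis
      by (simp add: A kronecker_sum_permute[OF f])
  qed
  then show ?thesis
    using E unfolding lumpable_def by (auto simp: level_superposition_def)
qed

lemma kronecker_sum_row:
  assumes fin: "\<And>j. j \<in> {1..n} \<Longrightarrow> finite (S j)" and A: "A \<in> (\<Pi>\<^sub>E j\<in>{1..n}. S j)"
  shows "(\<Sum>B\<in>(\<Pi>\<^sub>E j\<in>{1..n}. S j). kronecker_sum n D A B) =
    (\<Sum>j\<in>{1..n}. \<Sum>t\<in>S j. D j (A j) t)"
proof -
  let ?X = "\<Pi>\<^sub>E j\<in>{1..n}. S j"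
  let ?d = "\<lambda>B i. if A i = B i then 1 else (0::real)"
  have finX: "finite ?X" using fin by (intro finite_PiE) auto
  have row: "(\<Sum>B\<in>?X. D j (A j) (B j) * (\<Prod>i\<in>{1..n} - {j}. ?d B i)) = (\<Sum>t\<in>S j. D j (A j) t)"
    if j: "j \<in> {1..n}" for j
  proof -
    let ?Y = "(\<lambda>t. A(j := t)) ` S j"
    have Y: "?Y \<subseteq> ?X" using A j by (auto simp: PiE_iff extensional_def)
    have "(\<Prod>i\<in>{1..n} - {j}. ?d B i) = 0" if B: "B \<in> ?X - ?Y" for B
    proof (rule ccontr)
      assume "(\<Prod>i\<in>{1..n} - {j}. ?d B i) \<noteq> 0"
      then have eq: "A i = B i" if "i \<in> {1..n} - {j}" for i
        using that by (auto simp: prod_zero_iff split: if_splits)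
      have "A i = B i" if "i \<noteq> j" for i
        using eq[of i] that A B PiE_arb[of A _ S i] PiE_arb[of B _ S i]
        by (cases "i \<in> {1..n}") auto
      then have "B = A(j := B j)" by (auto simp: fun_eq_iff)
      moreover have "B j \<in> S j" using B j by (auto simp: PiE_iff)
      ultimately show False using B by blast
    qed
    then have "(\<Sum>B\<in>?X. D j (A j) (B j) * (\<Prod>i\<in>{1..n} - {j}. ?d B i)) =
        (\<Sum>B\<in>?Y. D j (A j) (B j) * (\<Prod>i\<in>{1..n} - {j}. ?d B i))"
      using Y finX by (intro sum.mono_neutral_right) auto
    also have "\<dots> = (\<Sum>t\<in>S j. D j (A j) t)"
      by (subst sum.reindex) (auto intro!: inj_onI dest: fun_upd_eqD)
    finally show ?thesis .
  qed
  have "(\<Sum>B\<in>?X. kronecker_sum n D A B) =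
      (\<Sum>j\<in>{1..n}. \<Sum>B\<in>?X. D j (A j) (B j) * (\<Prod>i\<in>{1..n} - {j}. ?d B i))"
    unfolding kronecker_sum_def by (rule sum.swap)
  also have "\<dots> = (\<Sum>j\<in>{1..n}. \<Sum>t\<in>S j. D j (A j) t)"
    by (rule sum.cong[OF refl row])
  finally show ?thesis .
qed

lemma is_MAP_level_superposition:
  assumes M: "\<And>j. j \<in> {1..n} \<Longrightarrow> is_MAP (M j)"
  shows "is_MAP (level_superposition n M)"
proof -
  let ?X = "\<Pi>\<^sub>E j\<in>{1..n}. mstates (M j)"
  have fin: "finite (mstates (M j))" and ne: "mstates (M j) \<noteq> {}"
    and row: "s \<in> mstates (M j) \<Longrightarrow> (\<Sum>t\<in>mstates (M j). hidden (M j) s t + active (M j) s t) = 0"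
    if "j \<in> {1..n}" for j s
    using M[OF that] by (auto simp: is_MAP_def)
  have "0 \<le> kronecker_sum n (\<lambda>j. hidden (M j)) A B"
    if AB: "A \<in> ?X" "B \<in> ?X" "A \<noteq> B" for A B
    unfolding kronecker_sum_def
  proof (rule sum_nonneg)
    fix j assume j: "j \<in> {1..n}"
    show "0 \<le> hidden (M j) (A j) (B j) * (\<Prod>i\<in>{1..n} - {j}. if A i = B i then 1 else 0)"
    proof (cases "\<forall>i\<in>{1..n} - {j}. A i = B i")
      case True
      then have "A j \<noteq> B j" using PiE_ext[OF AB(1,2)] AB(3) by blast
      then have "0 \<le> hidden (M j) (A j) (B j)"
        using M[OF j] AB j by (auto simp: is_MAP_def PiE_iff)
      then show ?thesis by (intro mult_nonneg_nonneg prod_nonneg) simp_all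
    next
      case False
      then have "(\<Prod>i\<in>{1..n} - {j}. if A i = B i then 1 else (0::real)) = 0"
        by (intro prod_zero) auto
      then show ?thesis by (metis mult_zero_right order_refl)
    qed
  qed
  moreover have "0 \<le> kronecker_sum n (\<lambda>j. active (M j)) A B"
    if AB: "A \<in> ?X" "B \<in> ?X" for A B
    unfolding kronecker_sum_def
  proof (intro sum_nonneg mult_nonneg_nonneg prod_nonneg)
    fix j assume j: "j \<in> {1..n}"
    show "0 \<le> active (M j) (A j) (B j)"
      using M[OF j] AB j by (auto simp: is_MAP_def PiE_iff)
  qed auto
  moreover have "(\<Sum>B\<in>?X. kronecker_sum n (\<lambda>j. hidden (M j)) A B
      + kronecker_sum n (\<lambda>j. active (M j)) A B) = 0" if A: "A \<in> ?X" for A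
  proof -
    have "(\<Sum>t\<in>mstates (M j). hidden (M j) (A j) t)
        + (\<Sum>t\<in>mstates (M j). active (M j) (A j) t) = 0" if j: "j \<in> {1..n}" for j
      using row[OF j PiE_mem[OF A j]] by (simp add: sum.distrib)
    then show ?thesis
      by (simp only: sum.distrib kronecker_sum_row[OF fin A])
         (simp add: sum.distrib[symmetric])
  qed
  moreover have "finite ?X" using fin by (intro finite_PiE) auto
  moreover have "?X \<noteq> {}" using ne by (simp add: PiE_eq_empty_iff)
  ultimately show ?thesis
    unfolding is_MAP_def by (simp add: level_superposition_def)
qed

lemma ex_refined_MAP:
  assumes "m \<ge> 1"
  shows "\<exists>M :: nat markov_ap. is_MAP M \<and> refined M \<and> card (mstates M) = m"
proof -
  let ?M = "\<lparr>mstates = {..<m}, hidden = \<lambda>s t. if s = t then - real s else 0,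
    active = \<lambda>s t. if s = t then real s else 0\<rparr>"
  have "s = t" if R: "lumpable ?M R" and st: "(s, t) \<in> R" for R s t
  proof -
    let ?C = "R `` {s}"
    have E: "equiv {..<m} R" using R by (simp add: lumpable_def)
    have "s \<in> {..<m}" "R \<subseteq> {..<m} \<times> {..<m}" using E st by (auto elim: equivE)
    then have C: "?C \<in> {..<m} // R" "s \<in> ?C" "t \<in> ?C" "finite ?C"
      using E st equiv_class_self[OF E]
      by (auto intro: quotientI finite_subset[of _ "{..<m}"])
    then have "(\<Sum>u\<in>?C. if s = u then real s else 0) = (\<Sum>u\<in>?C. if t = u then real t else 0)"
      using R st unfolding lumpable_def by fastforce
    then show "s = t" using C by (simp add: sum.delta')
  qed
  then have "refined ?M" unfolding refined_def equivalent_states_def by blast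
  moreover have "is_MAP ?M"
    using assms by (auto simp: is_MAP_def sum.distrib lessThan_empty_iff)
  ultimately show ?thesis by (intro exI[of _ ?M]) auto
qed

end

theory Submission
  imports Defs "HOL-Combinatorics.Permutations"
begin

text \<open>A tuple is determined up to a permutation of the sub-trees by the multiset of its entries,
  a multiset of size \<open>n\<close> over the \<open>m\<close> states. There are \<open>(m + n - 1) choose n\<close> of these,
  which equals \<open>(m + n - 1) choose (m - 1)\<close> and is therefore polynomially bounded in \<open>n\<close>.\<close>

text \<open>Equal multisets mean that \<open>A\<close> and \<open>B\<close> take each state at
  equally many indices, so bijections between their fibres glue to a permutation of
  \<open>{1..n}\<close>; conversely, reindexing preserves the multiset.\<close>

lemma subtree_equivalence_iff_image_mset:
  assumes "A \<in> {1..n} \<rightarrow>\<^sub>E mstates M" "B \<in> {1..n} \<rightarrow>\<^sub>E mstates M"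
  shows "(A, B) \<in> subtree_equivalence n M \<longleftrightarrow>
    image_mset A (mset_set {1..n}) = image_mset B (mset_set {1..n})"
proof
  assume "(A, B) \<in> subtree_equivalence n M"
  then obtain f where f: "f permutes {1..n}" and AB: "\<forall>i\<in>{1..n}. A i = B (f i)"
    unfolding subtree_equivalence_def by blast
  show "image_mset A (mset_set {1..n}) = image_mset B (mset_set {1..n})"
    by (rule permutes_implies_image_mset_eq[OF f, symmetric]) (use AB in blast)
next
  assume "image_mset A (mset_set {1..n}) = image_mset B (mset_set {1..n})"
  then obtain f where "f permutes {1..n}" "\<forall>i\<in>{1..n}. A i = B (f i)"
    using image_mset_eq_implies_permutes[of "{1..n}" A B] by auto
  then show "(A, B) \<in> subtree_equivalence n M"
    using assms unfolding subtree_equivalence_def by auto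
qed

lemma num_lumpable_partitions_le:
  assumes "finite (mstates M)"
  shows "num_lumpable_partitions n M \<le> (card (mstates M) + n - 1) choose n"
proof -
  let ?X = "{1..n} \<rightarrow>\<^sub>E mstates M"
  let ?c = "\<lambda>A. image_mset A (mset_set {1..n})"
  let ?Y = "multisets_of_size (mstates M) n"
  \<comment> \<open>Each class is a fibre of \<open>?c\<close>, so the multisets in
    \<open>?Y\<close> index a family of sets containing every class.\<close>
  have "subtree_equivalence n M `` {A} = {B \<in> ?X. ?c B = ?c A}" if "A \<in> ?X" for A
  proof (intro set_eqI)
    fix B
    show "B \<in> subtree_equivalence n M `` {A} \<longleftrightarrow> B \<in> {B \<in> ?X. ?c B = ?c A}"
      using subtree_equivalence_iff_image_mset[OF that, of B] subtree_equivalence_iff[of A B n M]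
      by (cases "B \<in> ?X") auto
  qed
  moreover have "?c A \<in> ?Y" if "A \<in> ?X" for A
    using PiE_mem[OF that] by (auto simp: multisets_of_size_def)
  ultimately have "lumpable_partitions n M \<subseteq> (\<lambda>N. {B \<in> ?X. ?c B = N}) ` ?Y"
    unfolding lumpable_partitions_def mstates_symmetric_superposition
    by (auto elim!: quotientE)
  then have "num_lumpable_partitions n M \<le> card ?Y"
    unfolding num_lumpable_partitions_def
    by (rule surj_card_le[OF finite_multisets_of_size[OF assms]])
  then show ?thesis
    by (simp add: card_multisets_of_size[OF assms])
qed

text \<open>The constant obtained, \<open>m ^ m\<close>, depends on \<open>m\<close> alone, so the
  MAP may vary with \<open>n\<close>.\<close>

theorem corollary2:
  fixes m :: nat and M :: "nat \<Rightarrow> 'a markov_ap"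
  assumes "m \<ge> 3"
    and "\<And>n. is_MAP (M n)"
    and "\<And>n. refined (M n)"
    and "\<And>n. card (mstates (M n)) = m"
  shows "(\<lambda>n. real (num_lumpable_partitions n (M n))) \<in> O(\<lambda>n. real n ^ m)"
proof (rule bigoI)
  \<comment> \<open>The case \<open>n = 0\<close> is excluded: there the empty tuple forms one
    class, while the right-hand side vanishes.\<close>
  have "real (num_lumpable_partitions n (M n)) \<le> real m ^ m * real n ^ m" if "n \<ge> 1" for n
  proof -
    obtain k where k: "m = Suc k" using assms(1) by (cases m) auto
    have "num_lumpable_partitions n (M n) \<le> (k + n) choose n"
      using num_lumpable_partitions_le[of "M n" n] assms(2,4) by (simp add: is_MAP_def k)
    also have "\<dots> = (k + n) choose k"
      by (subst binomial_symmetric) simp_all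
    also have "\<dots> \<le> (k + n) ^ k"
      by (rule binomial_le_pow) simp
    \<comment> \<open>The degree \<open>k\<close>, one less than \<open>m\<close>, is relaxed to the
      claimed one.\<close>
    also have "\<dots> \<le> (k + n) ^ m"
      using that by (intro power_increasing) (auto simp: k)
    \<comment> \<open>Since \<open>n \<ge> 1\<close>, \<open>k + n \<le> k * n + n = m * n\<close>;
      this yields the factor \<open>m ^ m\<close>.\<close>
    also have "\<dots> \<le> (m * n) ^ m"
      using that by (intro power_mono) (auto simp: k)
    finally have "num_lumpable_partitions n (M n) \<le> m ^ m * n ^ m"
      by (simp add: power_mult_distrib)
    then have "real (num_lumpable_partitions n (M n)) \<le> real (m ^ m * n ^ m)"
      by (rule of_nat_mono)
    then show ?thesis by simp
  qed
  then show "\<forall>\<^sub>F n in sequentially.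
      norm (real (num_lumpable_partitions n (M n))) \<le> real m ^ m * norm (real n ^ m)"
    by (intro eventually_sequentiallyI[of 1]) simp
qed

end
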